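(* Let $H$ be a real Hilbert space, let $k\in\mathbb{N}$, and let $(V_j)_{j\in\mathbb{N}}\subset\mathcal{G}^k(H)$ be a sequence of closed subspaces of codimension $k$. Then the set of all $(x_1,\dots,x_k)\in H^k$ such that $\mathrm{span}(x_1,\dots,x_k)$ is a well-separating common complement of $(V_j)_{j\in\mathbb{N}}$ is a prevalent subset of $H^k$.
   Context: All vector spaces are real and $\mathbb{N}=\{1,2,\dots\}$. For a Banach space $X$ (in particular a Hilbert space), $\mathcal{G}_k(X)$ is the set of $k$-dimensional subspaces of $X$ and $\mathcal{G}^k(X)$ is the set of closed subspaces of $X$ of codimension $k$. For $x\in X$ and $V\subset X$, $\mathrm{d}(x,V)=\inf_{v\in V}\|x-v\|$. Let $(V_j)_{j\in\mathbb{N}}\subset\mathcal{G}^k(X)$. A common complement of $(V_j)_{j\in\mathbb{N}}$ is a subspace $C\in\mathcal{G}_k(X)$ with $X=C\oplus V_j$ for all $j$. Given $\delta=(\delta_j)_{j\in\mathbb{N}}\subset\mathbb{R}_{>0}$, a common complement $C$ is called $\delta$-separating if $\inf_{x\in C,\ \|x\|=1}\mathrm{d}(x,V_j)\ge\delta_j$ for all $j\in\mathbb{N}$. It is called well-separating if it is $\delta$-separating for some $\delta=(\delta_j)_{j\in\mathbb{N}}\subset\mathbb{R}_{>0}$ with $\lim_{j\to\infty}\frac1j\log\delta_j=0$. The product $X^k$ is a Banach space with norm $\|(x_1,\dots,x_k)\|_{X^k}=\|x_1\|+\dots+\|x_k\|$. Prevalence: A Borel subset $E$ of a Banach space $Y$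 is called prevalent if there exists a Borel measure $\mu$ on $Y$ such that (1) $0<\mu(K)<\infty$ for some compact set $K\subset Y$, and (2) for all $y\in Y$ the translate $E+y$ has full $\mu$-measure (i.e. $\mu(Y\setminus(E+y))=0$). A general subset $F\subset Y$ is called prevalent if it contains a prevalent Borel set. *)

theory Defs
  imports "HOL-Analysis.Analysis"
begin

text \<open>
  Hilbert spaces are types of sort \<open>{real_inner, banach}\<close>, and the power \<open>H^k\<close> is the vector type
  \<open>'a ^ 'k\<close> with \<open>CARD('k) = k\<close>. Sequences are indexed by \<open>j \<ge> 1\<close>; values at \<open>j = 0\<close> are
  irrelevant.
\<close>

text \<open>
  A witnessing basis is used in place of \<open>dim\<close>, because \<open>dim\<close> is \<open>0\<close> on infinite-dimensional spaces.
\<close>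

definition subspaces_of_dim :: "nat \<Rightarrow> 'a::real_vector set set" where
  "subspaces_of_dim k =
     {C. subspace C \<and> (\<exists>B. finite B \<and> card B = k \<and> independent B \<and> span B = C)}"

text \<open>
  Codimension is the dimension of the quotient by \<open>V\<close>: the classes of the elements of \<open>B\<close> are linearly
  independent modulo \<open>V\<close> (in particular distinct) and span the quotient.
\<close>

definition has_codim :: "'a::real_vector set \<Rightarrow> nat \<Rightarrow> bool" where
  "has_codim V k \<longleftrightarrow>
     (\<exists>B. finite B \<and> card B = k
        \<and> (\<forall>c. (\<Sum>b\<in>B. c b *\<^sub>R b) \<in> V \<longrightarrow> (\<forall>b\<in>B. c b = 0))
        \<and> (\<forall>x. \<exists>c. x - (\<Sum>b\<in>B. c b *\<^sub>R b) \<in> V))"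

definition closed_subspaces_of_codim :: "nat \<Rightarrow> 'a::real_normed_vector set set" where
  "closed_subspaces_of_codim k = {V. subspace V \<and> closed V \<and> has_codim V k}"

definition direct_sum_UNIV :: "'a::real_vector set \<Rightarrow> 'a set \<Rightarrow> bool" where
  "direct_sum_UNIV C V \<longleftrightarrow> C \<inter> V = {0} \<and> (\<forall>x. \<exists>c\<in>C. \<exists>v\<in>V. x = c + v)"

definition common_complement ::
    "nat \<Rightarrow> (nat \<Rightarrow> 'a::real_normed_vector set) \<Rightarrow> 'a set \<Rightarrow> bool" where
  "common_complement k V C \<longleftrightarrow>
     C \<in> subspaces_of_dim k \<and> (\<forall>j\<ge>1. direct_sum_UNIV C (V j))"

text \<open>
  The infimum is that of a nonempty set of nonnegative reals as soon as \<open>k \<ge> 1\<close>; for \<open>k = 0\<close> the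
  unit sphere of \<open>C\<close> is empty and the definition is not meaningful.
\<close>

definition separating_complement ::
    "nat \<Rightarrow> (nat \<Rightarrow> 'a::real_normed_vector set) \<Rightarrow> (nat \<Rightarrow> real) \<Rightarrow> 'a set \<Rightarrow> bool" where
  "separating_complement k V \<delta> C \<longleftrightarrow>
     common_complement k V C \<and>
     (\<forall>j\<ge>1. (INF x\<in>{x \<in> C. norm x = 1}. infdist x (V j)) \<ge> \<delta> j)"

definition well_separating_complement ::
    "nat \<Rightarrow> (nat \<Rightarrow> 'a::real_normed_vector set) \<Rightarrow> 'a set \<Rightarrow> bool" where
  "well_separating_complement k V C \<longleftrightarrow>
     (\<exists>\<delta>. (\<forall>j\<ge>1. \<delta> j > 0) \<and> (\<lambda>j. (1 / real j) * ln (\<delta> j)) \<longlonglongrightarrow> 0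
        \<and> separating_complement k V \<delta> C)"

text \<open>
  Null sets are used rather than \<open>emeasure \<mu> _ = 0\<close>, since \<open>emeasure\<close> is \<open>0\<close> on every non-measurable
  set.
\<close>

definition prevalent_borel :: "'b::banach set \<Rightarrow> bool" where
  "prevalent_borel E \<longleftrightarrow>
     E \<in> sets borel \<and>
     (\<exists>\<mu>. sets \<mu> = sets borel
        \<and> (\<exists>K. compact K \<and> 0 < emeasure \<mu> K \<and> emeasure \<mu> K < \<infinity>)
        \<and> (\<forall>y. UNIV - (\<lambda>x. x + y) ` E \<in> null_sets \<mu>))"

definition prevalent :: "'b::banach set \<Rightarrow> bool" where
  "prevalent F \<longleftrightarrow> (\<exists>E\<subseteq>F. prevalent_borel E)"

text \<open>
  The type \<open>'a ^ 'k\<close> carries the Euclidean combination of the component norms instead of their sum.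
  The two norms are equivalent, so they have the same compact sets and the same Borel sets, which is
  all that prevalence depends on.
\<close>

lemma sum_norm_equiv:
  fixes x :: "'a::real_normed_vector ^ 'k"
  shows "norm x \<le> (\<Sum>i\<in>UNIV. norm (x $ i))"
    and "(\<Sum>i\<in>UNIV. norm (x $ i)) \<le> real CARD('k) * norm x"
proof -
  show "norm x \<le> (\<Sum>i\<in>UNIV. norm (x $ i))"
    unfolding norm_vec_def by (rule L2_set_le_sum) simp
  show "(\<Sum>i\<in>UNIV. norm (x $ i)) \<le> real CARD('k) * norm x"
    by (rule sum_bounded_above) (rule Finite_Cartesian_Product.norm_nth_le)
qed

end

theory Submission
  imports Defs "HOL-Probability.Infinite_Product_Measure"
begin

text \<open>
  Each \<open>V (Suc n)\<close> is the common kernel of the functionals \<open>inner (e n i)\<close> for an orthonormal family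
  \<open>e n\<close> indexed by \<open>'k\<close> (\<open>orthonormal_normal_vectors\<close>). For a tuple \<open>x\<close>, the position
  of \<open>span (range (\<lambda>i. x $ i))\<close> relative to \<open>V (Suc n)\<close> is governed by the matrix of the numbers
  \<open>inner (e n i) (x $ l)\<close>: if its determinant does not vanish, the span is a complement, and by
  Cramer's rule the distance from unit vectors of the span to \<open>V (Suc n)\<close> is at least a constant
  depending only on \<open>x\<close> times the absolute value of the determinant (\<open>gram_complement\<close>). Hence a
  well-separating complement is obtained as soon as these determinants are bounded from below by
  a fixed power of \<open>n\<close>, up to a factor independent of \<open>n\<close> (\<open>well_separating_if_det_bound\<close>).

  It remains to find a measure for which such a polynomial bound holds almost surely after every
  translation. In infinite dimension no measure spreads uniformly over all directions, so the
  measure has to be adapted to the sequence \<open>V\<close>: the component \<open>l\<close> of the random tuple is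
  the series of the vectors \<open>e n l\<close> with coefficients \<open>w n * \<xi> (n, l)\<close>, where
  \<open>w n = 1 / (n + 1)\<^sup>2\<close> and the \<open>\<xi> (n, l)\<close> are independent and uniform on \<open>[-1, 1]\<close>. The tuple depends
  continuously on \<open>\<xi>\<close> in the compact cube, so its law lives on a compact set.

  Fix \<open>n\<close> and a translation. As \<open>e n\<close> is orthonormal, the coefficient \<open>\<xi> (n, l)\<close> enters the \<open>n\<close>-th matrix
  only through the diagonal entry with index \<open>l\<close>, where it is multiplied by \<open>w n\<close>. The determinant is therefore
  affine in each of these coefficients, and the coefficient of their product is \<open>w n ^ k\<close>; such a function is
  smaller than \<open>(w n * s) ^ k\<close> with probability at most \<open>k * s\<close>, whatever the remaining entries are
  (\<open>det_anticoncentration\<close>). With \<open>s = \<epsilon> * w n\<close> these probabilities have a sum over \<open>n\<close> that tends to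
  \<open>0\<close> with \<open>\<epsilon>\<close>, so almost surely some \<open>\<epsilon>\<close> satisfies all the bounds at once.
\<close>

section \<open>Orthonormal normal vectors of a closed subspace of finite codimension\<close>

text \<open>
  A sequence in \<open>V\<close> whose distances to \<open>x\<close> tend to \<open>infdist x V\<close> is Cauchy by the parallelogram law, as
  midpoints stay in \<open>V\<close>; its limit is a nearest point, and the error at a nearest point is
  orthogonal to \<open>V\<close>.
\<close>

lemma orthogonal_projection_exists:
  fixes V :: "'a::{real_inner, banach} set"
  assumes V: "subspace V" "closed V"
  shows "\<exists>v\<in>V. \<forall>u\<in>V. inner (x - v) u = 0"
proof -
  define d where "d = infdist x V"
  have ne: "V \<noteq> {}" using V(1) subspace_0 by blast
  have d_le: "d \<le> norm (x - v)" if "v \<in> V" for v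
    using infdist_le[OF that, of x] by (simp add: d_def dist_norm)
  have "\<exists>v\<in>V. norm (x - v) < d + inverse (real (Suc n))" for n
  proof (rule ccontr)
    assume "\<not> ?thesis"
    then have "\<And>v. v \<in> V \<Longrightarrow> d + inverse (real (Suc n)) \<le> dist x v"
      by (force simp: dist_norm not_less)
    then have "d + inverse (real (Suc n)) \<le> d"
      unfolding d_def using ne by (subst (2) infdist_notempty) (auto intro!: cINF_greatest)
    then show False by simp
  qed
  then obtain v where vV: "\<And>n. v n \<in> V" and vd: "\<And>n. norm (x - v n) < d + inverse (real (Suc n))"
    by metis
  have d0: "d \<ge> 0" by (simp add: d_def infdist_nonneg)
  have lim: "(\<lambda>n. norm (x - v n)) \<longlonglongrightarrow> d"
  proof (rule tendsto_sandwich[OF _ _ tendsto_const])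
    show "(\<lambda>n. d + inverse (real (Suc n))) \<longlonglongrightarrow> d"
      using tendsto_add[OF tendsto_const LIMSEQ_inverse_real_of_nat, of d] by simp
  qed (use d_le vV vd in \<open>auto intro!: always_eventually less_imp_le\<close>)
  have para: "(norm (v m - v n))\<^sup>2 \<le> 2 * (norm (x - v m))\<^sup>2 + 2 * (norm (x - v n))\<^sup>2 - 4 * d\<^sup>2" for m n
  proof -
    have "(1/2) *\<^sub>R (v m + v n) \<in> V" using V(1) vV by (simp add: subspace_add subspace_scale)
    from d_le[OF this] d0 have "d\<^sup>2 \<le> (norm (x - (1/2) *\<^sub>R (v m + v n)))\<^sup>2"
      by (simp add: power_mono)
    then show ?thesis
      by (simp add: power2_norm_eq_inner algebra_simps inner_commute)
  qed
  have "Cauchy v"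
  proof (rule metric_CauchyI)
    fix e :: real assume e: "e > 0"
    have "(\<lambda>n. 2 * ((norm (x - v n))\<^sup>2 - d\<^sup>2)) \<longlonglongrightarrow> 2 * (d\<^sup>2 - d\<^sup>2)"
      by (intro tendsto_intros lim)
    then have "\<forall>\<^sub>F n in sequentially. 2 * ((norm (x - v n))\<^sup>2 - d\<^sup>2) < e\<^sup>2 / 2"
      using e by (intro order_tendstoD) auto
    then obtain N where N: "\<And>n. n \<ge> N \<Longrightarrow> 2 * ((norm (x - v n))\<^sup>2 - d\<^sup>2) < e\<^sup>2 / 2"
      by (auto simp: eventually_sequentially)
    have "dist (v m) (v n) < e" if "m \<ge> N" "n \<ge> N" for m n
    proof -
      have "(norm (v m - v n))\<^sup>2 < e\<^sup>2"
        using para[of m n] N[OF that(1)] N[OF that(2)] by argo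
      then show ?thesis using e by (simp add: dist_norm power2_less_imp_less)
    qed
    then show "\<exists>M. \<forall>m\<ge>M. \<forall>n\<ge>M. dist (v m) (v n) < e" by blast
  qed
  then obtain p where p: "v \<longlonglongrightarrow> p" by (meson Cauchy_convergent_iff convergent_def)
  have pV: "p \<in> V" using closed_sequentially[OF V(2) _ p] vV by blast
  have pd: "norm (x - p) = d"
    by (rule LIMSEQ_unique[OF _ lim]) (intro tendsto_intros p)
  have "inner (x - p) u = 0" if u: "u \<in> V" for u
  proof (cases "u = 0")
    case False
    \<comment> \<open>The value of \<open>t\<close> for which \<open>p + t *\<^sub>R u\<close> is nearest to \<open>x\<close> on that line.\<close>
    define t where "t = inner (x - p) u / inner u u"
    have uu: "inner u u > 0" using False by simp
    have "p + t *\<^sub>R u \<in> V" using V(1) pV u by (simp add: subspace_add subspace_scale)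
    from d_le[OF this] have "(norm (x - p))\<^sup>2 \<le> (norm (x - (p + t *\<^sub>R u)))\<^sup>2"
      by (simp add: pd d0 power_mono)
    also have "x - (p + t *\<^sub>R u) = (x - p) - t *\<^sub>R u" by simp
    finally have "2 * t * inner (x - p) u \<le> t * t * inner u u"
      by (simp add: power2_norm_eq_inner inner_diff_left inner_diff_right inner_commute algebra_simps)
    then have "(inner (x - p) u)\<^sup>2 / inner u u \<le> 0"
      using uu by (simp add: t_def power2_eq_square)
    then show ?thesis using uu by (simp add: divide_le_0_iff)
  qed simp
  with pV show ?thesis by blast
qed

lemma span_range_family:
  fixes x :: "'k::finite \<Rightarrow> 'a::real_vector"
  shows "span (range x) = {\<Sum>l\<in>UNIV. c l *\<^sub>R x l |c. True}" (is "_ = ?R")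
proof (rule span_unique)
  show "range x \<subseteq> ?R"
  proof clarify
    fix i have "x i = (\<Sum>l\<in>UNIV. (if l = i then 1 else 0) *\<^sub>R x l)"
      by (simp add: if_distrib[of "\<lambda>a. a *\<^sub>R _"] cong: if_cong)
    then show "\<exists>c. x i = (\<Sum>l\<in>UNIV. c l *\<^sub>R x l) \<and> True" by (intro exI[of _ "\<lambda>l. if l = i then 1 else 0"]) simp
  qed
  show "subspace ?R"
    unfolding subspace_def
  proof (safe, goal_cases)
    case 1 show ?case by (intro exI[of _ "\<lambda>_. 0"]) simp
  next
    case (2 _ _ c c')
    show ?case by (intro exI[of _ "\<lambda>l. c l + c' l"]) (simp add: scaleR_add_left sum.distrib)
  next
    case (3 a _ c)
    show ?case by (intro exI[of _ "\<lambda>l. a * c l"]) (simp add: scaleR_sum_right)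
  qed
  show "\<And>T'. range x \<subseteq> T' \<Longrightarrow> subspace T' \<Longrightarrow> ?R \<subseteq> T'"
    by (auto intro!: subspace_sum subspace_scale)
qed

lemma independent_familyI:
  fixes x :: "'k::finite \<Rightarrow> 'a::real_vector"
  assumes "\<And>c. (\<Sum>l\<in>UNIV. c l *\<^sub>R x l) = 0 \<Longrightarrow> c = (\<lambda>_. 0)"
  shows "inj x" "independent (range x)"
proof -
  show inj: "inj x"
  proof (rule injI, rule ccontr)
    fix i j assume ij: "x i = x j" "i \<noteq> j"
    define c where "c l = (if l = i then 1 else 0) - (if l = j then 1 else (0::real))" for l
    have "(\<Sum>l\<in>UNIV. c l *\<^sub>R x l) = 0"
      using ij by (simp add: c_def scaleR_diff_left sum_subtractf if_distrib[of "\<lambda>a. a *\<^sub>R _"] cong: if_cong)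
    from assms[OF this] have "c i = 0" by simp
    then show False using ij by (simp add: c_def)
  qed
  show "independent (range x)"
  proof (rule independent_if_scalars_zero)
    fix f v assume *: "(\<Sum>v\<in>range x. f v *\<^sub>R v) = 0" and v: "v \<in> range x"
    have "(\<Sum>l\<in>UNIV. (f \<circ> x) l *\<^sub>R x l) = 0"
      using * by (subst (asm) sum.reindex[OF inj]) (simp add: o_def)
    from assms[OF this] v show "f v = 0" by (auto simp: fun_eq_iff)
  qed simp
qed

text \<open>
  Subtracting from a basis modulo \<open>V\<close> its orthogonal projections to \<open>V\<close> gives as many linearly independent
  vectors orthogonal to \<open>V\<close>; orthogonalisation and normalisation make them orthonormal. A vector
  orthogonal to all of them has no component outside \<open>V\<close>.
\<close>

lemma orthonormal_normal_vectors:
  fixes V :: "'a::{real_inner, banach} set"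
  assumes "V \<in> closed_subspaces_of_codim CARD('k::finite)"
  shows "\<exists>e :: 'k \<Rightarrow> 'a. (\<forall>i j. inner (e i) (e j) = (if i = j then 1 else 0))
           \<and> V = {x. \<forall>i. inner (e i) x = 0}"
proof -
  from assms have V: "subspace V" "closed V" and "has_codim V CARD('k)"
    by (auto simp: closed_subspaces_of_codim_def)
  then obtain B where B: "finite B" "card B = CARD('k)"
      and Bind: "\<And>c. (\<Sum>b\<in>B. c b *\<^sub>R b) \<in> V \<Longrightarrow> \<forall>b\<in>B. c b = 0"
      and Bspan: "\<And>x. \<exists>c. x - (\<Sum>b\<in>B. c b *\<^sub>R b) \<in> V"
    unfolding has_codim_def by blast
  obtain b :: "'k \<Rightarrow> 'a" where b: "bij_betw b UNIV B"
    using finite_same_card_bij[of "UNIV :: 'k set" B] B by auto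
  have sumB: "(\<Sum>v\<in>B. c v *\<^sub>R v) = (\<Sum>l\<in>UNIV. c (b l) *\<^sub>R b l)" for c
    by (rule sum.reindex_bij_betw[OF b, symmetric])
  have "\<forall>l. \<exists>v. v \<in> V \<and> (\<forall>u\<in>V. inner (b l - v) u = 0)"
    using orthogonal_projection_exists[OF V] by blast
  from choice[OF this] obtain p where pV: "\<And>l. p l \<in> V"
      and p: "\<And>l u. u \<in> V \<Longrightarrow> inner (b l - p l) u = 0"
    by blast
  define w where "w l = b l - p l" for l
  have wsum: "(\<Sum>l\<in>UNIV. c l *\<^sub>R b l) - (\<Sum>l\<in>UNIV. c l *\<^sub>R w l) \<in> V" for c
    unfolding w_def sum_subtractf[symmetric] scaleR_diff_right[symmetric]
    by (rule subspace_sum[OF V(1)]) (simp add: pV V(1) subspace_scale)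
  have w0: "c = (\<lambda>_. 0)" if "(\<Sum>l\<in>UNIV. c l *\<^sub>R w l) = 0" for c
  proof -
    have "(\<Sum>v\<in>B. c (inv b v) *\<^sub>R v) \<in> V"
      using wsum[of c] that b by (simp add: sumB bij_betw_def)
    from Bind[OF this] b show ?thesis by (fastforce simp: bij_betw_def)
  qed
  note wind = independent_familyI[OF w0]
  obtain C where C: "finite C" "card C \<le> card (range w)" "span C = span (range w)" "pairwise orthogonal C"
    using basis_orthogonal[of "range w"] by auto
  \<comment> \<open>Orthogonalisation yields at most as many vectors, possibly with a zero vector among them; counting
    dimensions shows that the nonzero ones are exactly as many.\<close>
  have cardw: "card (range w) = CARD('k)" by (simp add: card_image wind)
  have "card (range w) \<le> card (C - {0})"
    using independent_span_bound[of "C - {0}" "range w"] C wind(2)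
    by (metis finite_Diff span_delete_0 span_superset)
  moreover have "card (C - {0}) \<le> card C" using C(1) by (simp add: card_mono)
  ultimately have "card (C - {0}) = CARD('k)" using C(2) cardw by linarith
  then obtain f :: "'k \<Rightarrow> 'a" where f: "bij_betw f UNIV (C - {0})"
    using finite_same_card_bij[of "UNIV :: 'k set" "C - {0}"] C by auto
  have f0: "f i \<noteq> 0" for i using f by (auto simp: bij_betw_def)
  have forth: "inner (f i) (f j) = 0" if "i \<noteq> j" for i j
  proof -
    have "f i \<in> C" "f j \<in> C" "f i \<noteq> f j" using f that by (auto simp: bij_betw_def inj_eq)
    then show ?thesis using C(4) by (auto simp: pairwise_def orthogonal_def)
  qed
  have spanf: "span (range f) = span (range w)"
    using f C(3) by (simp add: bij_betw_def)
  define e where "e i = (1 / norm (f i)) *\<^sub>R f i" for i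
  have orth: "inner (e i) (e j) = (if i = j then 1 else 0)" for i j
    using f0 by (simp add: e_def forth dot_square_norm power2_eq_square)
  have "inner (e i) x = 0" if "x \<in> V" for x i
  proof -
    have "f i \<in> span (range w)" unfolding spanf[symmetric] by (simp add: span_base)
    then obtain c where "f i = (\<Sum>l\<in>UNIV. c l *\<^sub>R w l)" by (auto simp: span_range_family)
    then show ?thesis using p[OF that] by (simp add: e_def inner_sum_left w_def)
  qed
  moreover have "x \<in> V" if ex: "\<And>i. inner (e i) x = 0" for x
  proof -
    obtain c where c: "x - (\<Sum>v\<in>B. c v *\<^sub>R v) \<in> V" using Bspan by blast
    define u where "u = (\<Sum>l\<in>UNIV. c (b l) *\<^sub>R w l)"
    have xu: "x - u \<in> V"
      using subspace_add[OF V(1) c wsum[of "c \<circ> b"]] by (simp add: sumB u_def)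
    have "u \<in> span (range f)" unfolding spanf u_def by (auto simp: span_range_family)
    then obtain c' where c': "u = (\<Sum>l\<in>UNIV. c' l *\<^sub>R f l)" by (auto simp: span_range_family)
    have "inner (f i) x = 0" for i using ex[of i] f0[of i] by (simp add: e_def)
    then have "inner u x = 0" by (simp add: c' inner_sum_left)
    moreover have "inner u (x - u) = 0" using p[OF xu] by (simp add: u_def inner_sum_left w_def)
    ultimately have "u = 0" by (simp add: inner_diff_right)
    then show ?thesis using xu by simp
  qed
  ultimately have "V = {x. \<forall>i. inner (e i) x = 0}" by blast
  with orth show ?thesis by blast
qed

section \<open>Separation of a complement in terms of a determinant\<close>

text \<open>
  Leibniz' formula; the bounds depend on the column because Cramer's rule replaces one column by
  a vector of a different size.
\<close>

lemma abs_det_le: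
  fixes A :: "real^'k^'k"
  assumes "\<And>i j. \<bar>A $ i $ j\<bar> \<le> b j"
  shows "\<bar>det A\<bar> \<le> fact CARD('k) * (\<Prod>j\<in>UNIV. b j)"
proof -
  have "\<bar>det A\<bar> = \<bar>det (transpose A)\<bar>" by simp
  also have "\<dots> \<le> (\<Sum>p\<in>{p. p permutes (UNIV :: 'k set)}. \<bar>of_int (sign p) * (\<Prod>i\<in>UNIV. transpose A $ i $ p i)\<bar>)"
    unfolding det_def by (rule sum_abs)
  also have "\<dots> \<le> (\<Sum>p\<in>{p. p permutes (UNIV :: 'k set)}. \<Prod>j\<in>UNIV. b j)"
  proof (rule sum_mono)
    fix p :: "'k \<Rightarrow> 'k"
    show "\<bar>of_int (sign p) * (\<Prod>i\<in>UNIV. transpose A $ i $ p i)\<bar> \<le> (\<Prod>j\<in>UNIV. b j)"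
      using assms by (auto simp: abs_mult abs_prod transpose_def sign_def intro!: prod_mono)
  qed
  also have "\<dots> = fact CARD('k) * (\<Prod>j\<in>UNIV. b j)"
    by (simp add: card_permutations)
  finally show ?thesis .
qed

text \<open>
  The rows belong to the vectors of the tuple, so that changing one vector changes one row, which is
  the form in which multilinearity of \<open>det\<close> is used below.
\<close>

definition gram :: "('k \<Rightarrow> 'a::real_inner) \<Rightarrow> 'a ^ 'k \<Rightarrow> real ^ 'k ^ 'k" where
  "gram e x = (\<chi> l i. inner (e i) (x $ l))"

lemma vector_gram_mult:
  "(c v* gram e x) $ i = inner (e i) (\<Sum>l\<in>UNIV. c $ l *\<^sub>R x $ l)"
  by (simp add: gram_def vector_matrix_mult_def inner_sum_right mult.commute)

text \<open>
  Cramer's rule expresses \<open>c $ l\<close> times the determinant as the determinant in which column \<open>l\<close> of the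
  transposed matrix, bounded by \<open>M\<close>, has been replaced by the vector of inner products, bounded by \<open>d\<close>.
\<close>

lemma cramer_bound:
  fixes e :: "'k::finite \<Rightarrow> 'a::real_inner"
  assumes e: "\<And>i. norm (e i) = 1"
    and M: "\<And>l. norm (x $ l) \<le> M"
    and d: "\<And>i. \<bar>inner (e i) (\<Sum>l\<in>UNIV. c $ l *\<^sub>R x $ l)\<bar> \<le> d"
  shows "\<bar>c $ l\<bar> * \<bar>det (gram e x)\<bar> \<le> fact CARD('k) * (d * M ^ (CARD('k) - 1))"
proof -
  let ?A = "transpose (gram e x)"
  let ?b = "\<lambda>j. if j = l then d else M"
  have entry: "\<bar>?A $ i $ j\<bar> \<le> M" for i j
    using Cauchy_Schwarz_ineq2[of "e i" "x $ j"] e[of i] M[of j]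
    by (simp add: gram_def transpose_def)
  have "\<bar>c $ l\<bar> * \<bar>det (gram e x)\<bar> = \<bar>c $ l * det ?A\<bar>" by (simp add: abs_mult)
  also have "c $ l * det ?A = det (\<chi> i j. if j = l then (?A *v c) $ i else ?A $ i $ j)"
    by (rule cramer_lemma[symmetric])
  also have "\<bar>\<dots>\<bar> \<le> fact CARD('k) * (\<Prod>j\<in>UNIV. ?b j)"
    by (rule abs_det_le) (use entry d in \<open>auto simp: vector_gram_mult\<close>)
  also have "(\<Prod>j\<in>UNIV. ?b j) = d * M ^ (CARD('k) - 1)"
    by (subst prod.remove[of _ l]) (simp_all add: prod.If_cases)
  finally show ?thesis .
qed

text \<open>
  A unit vector \<open>y\<close> of the span has a coefficient of size at least \<open>1 / (k * M)\<close>, and all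
  \<open>\<bar>inner (e i) y\<bar>\<close> are at most its distance to \<open>V\<close>; \<open>cramer_bound\<close> turns this into a lower bound for
  the distance. Any vector splits along the span and \<open>V\<close>, because its inner products with the \<open>e i\<close> can
  be matched by solving a linear system with an invertible matrix.
\<close>

lemma gram_complement:
  fixes e :: "'k::finite \<Rightarrow> 'a::real_inner" and M :: real
  assumes orth: "\<And>i j. inner (e i) (e j) = (if i = j then 1 else 0)"
    and V: "V = {x. \<forall>i. inner (e i) x = 0}"
    and det: "det (gram e x) \<noteq> 0"
  defines "C \<equiv> span (range (\<lambda>i. x $ i))"
    and "M \<equiv> \<Sum>l\<in>UNIV. norm (x $ l)"
  shows "C \<in> subspaces_of_dim CARD('k)" "direct_sum_UNIV C V" "M > 0"
    "(INF y\<in>{y \<in> C. norm y = 1}. infdist y V) \<ge> \<bar>det (gram e x)\<bar> / (CARD('k) * fact CARD('k) * M ^ CARD('k))"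
proof -
  have e1: "norm (e i) = 1" for i using orth[of i i] by (simp add: norm_eq_1)
  have Ml: "norm (x $ l) \<le> M" for l unfolding M_def by (rule member_le_sum) auto
  have ker: "c = 0" if "\<And>i. inner (e i) (\<Sum>l\<in>UNIV. c $ l *\<^sub>R x $ l) = 0" for c :: "real^'k"
  proof -
    have "\<bar>c $ l\<bar> * \<bar>det (gram e x)\<bar> \<le> fact CARD('k) * (0 * M ^ (CARD('k) - 1))" for l
      by (rule cramer_bound[OF e1 Ml]) (simp add: that)
    then have "c $ l = 0" for l using det by (simp add: mult_le_0_iff)
    then show ?thesis by (simp add: vec_eq_iff)
  qed
  have ind: "c = (\<lambda>_. 0)" if "(\<Sum>l\<in>UNIV. c l *\<^sub>R x $ l) = 0" for c :: "'k \<Rightarrow> real"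
    using ker[of "\<chi> l. c l"] that by (simp add: vec_eq_iff fun_eq_iff)
  note fam = independent_familyI[OF ind]
  show dimC: "C \<in> subspaces_of_dim CARD('k)"
    unfolding subspaces_of_dim_def C_def
    by (intro CollectI conjI exI[of _ "range (\<lambda>i. x $ i)"]) (auto simp: fam card_image)
  have C: "C = {\<Sum>l\<in>UNIV. c l *\<^sub>R x $ l |c. True}" unfolding C_def by (rule span_range_family)
  show "direct_sum_UNIV C V"
    unfolding direct_sum_UNIV_def
  proof
    show "C \<inter> V = {0}"
    proof
      show "{0} \<subseteq> C \<inter> V" by (simp add: V C_def span_zero)
      show "C \<inter> V \<subseteq> {0}"
      proof
        fix y assume "y \<in> C \<inter> V"
        then obtain c where c: "y = (\<Sum>l\<in>UNIV. c l *\<^sub>R x $ l)" and "\<And>i. inner (e i) y = 0" by (auto simp: C V)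
        with ker[of "\<chi> l. c l"] show "y \<in> {0}" by (auto simp: vec_eq_iff)
      qed
    qed
    show "\<forall>z. \<exists>c\<in>C. \<exists>v\<in>V. z = c + v"
    proof
      fix z
      have "invertible (transpose (gram e x))" using det by (simp add: invertible_det_nz)
      then obtain c where c: "transpose (gram e x) *v c = (\<chi> i. inner (e i) z)"
        by (metis invertible_def matrix_vector_mul_assoc matrix_vector_mul_lid)
      define y where "y = (\<Sum>l\<in>UNIV. c $ l *\<^sub>R x $ l)"
      have "inner (e i) (z - y) = 0" for i
        using arg_cong[OF c, of "\<lambda>v. v $ i"] by (simp add: vector_gram_mult y_def inner_diff_right)
      then have "z - y \<in> V" by (simp add: V)
      moreover have "y \<in> C" by (auto simp: C y_def)
      ultimately show "\<exists>c\<in>C. \<exists>v\<in>V. z = c + v" by (intro bexI[of _ y] bexI[of _ "z - y"]) auto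
    qed
  qed
  obtain l0 :: 'k where True by simp
  have xl0: "x $ l0 \<noteq> 0"
    using ind[of "\<lambda>l. if l = l0 then 1 else 0"]
    by (auto simp: fun_eq_iff if_distrib[of "\<lambda>a. a *\<^sub>R _"] cong: if_cong split: if_splits)
  then show M0: "M > 0" using Ml[of l0] by (smt (verit) norm_eq_zero norm_ge_zero)
  let ?k = "CARD('k)"
  show "(INF y\<in>{y \<in> C. norm y = 1}. infdist y V) \<ge> \<bar>det (gram e x)\<bar> / (?k * fact ?k * M ^ ?k)"
  proof (rule cINF_greatest)
    have "(1 / norm (x $ l0)) *\<^sub>R x $ l0 \<in> C" unfolding C_def by (intro span_scale span_base) auto
    moreover have "norm ((1 / norm (x $ l0)) *\<^sub>R x $ l0) = 1" using xl0 by simp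
    ultimately show "{y \<in> C. norm y = 1} \<noteq> {}" by blast
  next
    fix y assume "y \<in> {y \<in> C. norm y = 1}"
    then obtain c where c: "y = (\<Sum>l\<in>UNIV. c l *\<^sub>R x $ l)" and y1: "norm y = 1" by (auto simp: C)
    have V0: "0 \<in> V" by (simp add: V)
    have dist: "\<bar>inner (e i) y\<bar> \<le> infdist y V" for i
    proof -
      have "\<bar>inner (e i) y\<bar> \<le> dist y v" if "v \<in> V" for v
        using Cauchy_Schwarz_ineq2[of "e i" "y - v"] that
        by (simp add: e1 V inner_diff_right dist_norm)
      then show ?thesis using V0 by (subst infdist_notempty) (auto intro!: cINF_greatest)
    qed
    have cb: "\<bar>c l\<bar> * \<bar>det (gram e x)\<bar> \<le> fact ?k * (infdist y V * M ^ (?k - 1))" for l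
      using cramer_bound[of e x M "\<chi> l. c l" "infdist y V" l] e1 Ml dist by (simp add: c)
    have "1 \<le> (\<Sum>l\<in>UNIV. \<bar>c l\<bar> * norm (x $ l))"
      using norm_sum[of "\<lambda>l. c l *\<^sub>R x $ l" UNIV] y1 by (simp add: c)
    also have "\<dots> \<le> (\<Sum>l\<in>UNIV. \<bar>c l\<bar> * M)" by (intro sum_mono mult_left_mono Ml) auto
    finally have "1 * \<bar>det (gram e x)\<bar> \<le> (\<Sum>l\<in>UNIV. \<bar>c l\<bar> * M) * \<bar>det (gram e x)\<bar>"
      by (rule mult_right_mono) simp
    also have "\<dots> = (\<Sum>l\<in>UNIV. (\<bar>c l\<bar> * \<bar>det (gram e x)\<bar>) * M)"
      by (simp add: sum_distrib_left mult_ac)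
    also have "\<dots> \<le> (\<Sum>l\<in>(UNIV :: 'k set). (fact ?k * (infdist y V * M ^ (?k - 1))) * M)"
      using M0 by (intro sum_mono mult_right_mono cb) auto
    also have "\<dots> = infdist y V * (?k * fact ?k * M ^ ?k)"
      using power_minus_mult[of ?k M] by (simp add: mult_ac flip: power_minus_mult[of ?k M])
    finally show "\<bar>det (gram e x)\<bar> / (?k * fact ?k * M ^ ?k) \<le> infdist y V"
      using M0 by (subst pos_divide_le_eq) (auto intro!: mult_pos_pos)
  qed
qed

lemma continuous_gram: "continuous_on S f \<Longrightarrow> continuous_on S (\<lambda>x. gram e (f x))"
  unfolding gram_def by (intro continuous_on_vec_lambda continuous_intros)

lemma continuous_det:
  fixes f :: "'b::topological_space \<Rightarrow> real ^ 'k ^ 'k"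
  shows "continuous_on S f \<Longrightarrow> continuous_on S (\<lambda>x. det (f x))"
  unfolding det_def by (intro continuous_intros)

lemma subexponential_separation:
  assumes "\<epsilon> > 0" "C > (0::real)"
  shows "(\<lambda>j. (1 / real j) * ln ((1 / real j ^ 2 * (\<epsilon> * (1 / real j ^ 2))) ^ k / C)) \<longlonglongrightarrow> 0"
proof -
  have "(\<lambda>j. (k * ln \<epsilon> - ln C) * (1 / real j) - 4 * real k * (ln (real j) / real j)) \<longlonglongrightarrow>
      (k * ln \<epsilon> - ln C) * 0 - 4 * real k * 0"
    by (intro tendsto_intros lim_ln_over_n lim_1_over_n)
  moreover have "\<forall>\<^sub>F j in sequentially. (k * ln \<epsilon> - ln C) * (1 / real j) - 4 * real k * (ln (real j) / real j)
     = (1 / real j) * ln ((1 / real j ^ 2 * (\<epsilon> * (1 / real j ^ 2))) ^ k / C)"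
    using eventually_gt_at_top[of 0]
  proof eventually_elim
    case (elim j)
    then show ?case using assms
      by (simp add: ln_div ln_mult ln_realpow field_simps)
  qed
  ultimately show ?thesis by (simp add: tendsto_cong)
qed

text \<open>
  The determinant may decay polynomially, because \<open>ln\<close> of a polynomial is negligible against \<open>j\<close>. The
  two factors \<open>1 / (n + 1)\<^sup>2\<close> are kept apart because they arise differently in the probabilistic
  estimate: one is the weight of the random coefficients, the one next to \<open>\<epsilon>\<close> makes the failure
  probabilities summable.
\<close>

lemma well_separating_if_det_bound:
  fixes V :: "nat \<Rightarrow> 'a::{real_inner, banach} set" and e :: "nat \<Rightarrow> 'k::finite \<Rightarrow> 'a"
  assumes orth: "\<And>n i j. inner (e n i) (e n j) = (if i = j then 1 else 0)"
    and V: "\<And>n. V (Suc n) = {x. \<forall>i. inner (e n i) x = 0}"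
    and \<epsilon>: "\<epsilon> > 0"
    and det: "\<And>n. \<bar>det (gram (e n) x)\<bar> \<ge> (1 / real (Suc n) ^ 2 * (\<epsilon> * (1 / real (Suc n) ^ 2))) ^ CARD('k)"
  shows "well_separating_complement CARD('k) V (span (range (\<lambda>i. x $ i)))"
proof -
  let ?k = "CARD('k)" and ?S = "span (range (\<lambda>i. x $ i))"
  define C where "C = ?k * fact ?k * (\<Sum>l\<in>UNIV. norm (x $ l)) ^ ?k"
  define \<delta> where "\<delta> j = (1 / real j ^ 2 * (\<epsilon> * (1 / real j ^ 2))) ^ ?k / C" for j
  have "(1 / real (Suc n) ^ 2 * (\<epsilon> * (1 / real (Suc n) ^ 2))) ^ ?k > 0" for n using \<epsilon> by (simp del: of_nat_Suc)
  then have "det (gram (e n) x) \<noteq> 0" for n using det[of n] by (smt (verit, best))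
  note comp = gram_complement[OF orth V this]
  have C: "C > 0" using comp(3) by (auto simp: C_def intro!: mult_pos_pos)
  have sep: "separating_complement ?k V \<delta> ?S"
    unfolding separating_complement_def common_complement_def
  proof (intro conjI allI impI)
    show "?S \<in> subspaces_of_dim ?k" by (rule comp(1))
    fix j :: nat assume "j \<ge> 1"
    then obtain n where j: "j = Suc n" by (cases j) auto
    show "direct_sum_UNIV ?S (V j)" unfolding j by (rule comp(2))
    have "\<delta> j \<le> \<bar>det (gram (e n) x)\<bar> / C"
      unfolding \<delta>_def j using C by (intro divide_right_mono det) auto
    also have "\<dots> \<le> (INF y\<in>{y \<in> ?S. norm y = 1}. infdist y (V j))"
      unfolding j C_def using comp(4) by simp
    finally show "\<delta> j \<le> \<dots>" .
  qed
  show ?thesis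
    unfolding well_separating_complement_def
    by (intro exI[of _ \<delta>] conjI sep)
      (use \<epsilon> C subexponential_separation[OF \<epsilon> C, of ?k] in \<open>auto simp: \<delta>_def\<close>)
qed

section \<open>Independent uniform coefficients\<close>

abbreviation unif :: "real measure" where "unif \<equiv> uniform_measure lborel {-1..1}"
abbreviation cube :: "('i::countable \<Rightarrow> real) measure" where "cube \<equiv> PiM UNIV (\<lambda>_. unif)"

text \<open>
  Random series are formed with clamped coefficients, so that they converge and depend continuously
  on the coefficients on the whole product space and not only on the cube.
\<close>

definition clamp1 :: "real \<Rightarrow> real" where "clamp1 t = max (-1) (min 1 t)"

lemma clamp1_simps: "\<bar>clamp1 t\<bar> \<le> 1" "clamp1 (clamp1 t) = clamp1 t" "t \<in> {-1..1} \<Longrightarrow> clamp1 t = t"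
  by (auto simp: clamp1_def)

lemma continuous_clamp1: "continuous_on A f \<Longrightarrow> continuous_on A (\<lambda>x. clamp1 (f x))"
  unfolding clamp1_def by (intro continuous_intros)

lemma prob_space_unif: "prob_space unif"
  by (rule prob_space_uniform_measure) auto

lemma prob_space_cube: "prob_space cube"
  by (rule prob_space_PiM) (rule prob_space_unif)

lemma sets_cube: "sets (cube :: ('i::countable \<Rightarrow> real) measure) = sets borel"
proof -
  have "sets (cube :: ('i \<Rightarrow> real) measure) = sets (PiM UNIV (\<lambda>_. borel))"
    by (rule sets_PiM_cong) auto
  then show ?thesis by (simp add: sets_PiM_equal_borel)
qed

lemma space_cube [simp]: "space cube = UNIV"
  by (simp add: space_PiM)

text \<open>
  Resampling one coordinate independently does not change the product measure, so Fubini's theorem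
  reduces a bound for a set to a uniform bound for its slices in one coordinate.
\<close>

lemma emeasure_cube_le_slice:
  fixes A :: "('i::countable \<Rightarrow> real) set"
  assumes A: "A \<in> sets cube" and c: "\<And>X. emeasure unif {t. X(i := t) \<in> A} \<le> c"
  shows "emeasure cube A \<le> c"
proof -
  interpret U: prob_space unif by (rule prob_space_unif)
  interpret P: prob_space "cube :: ('i \<Rightarrow> real) measure" by (rule prob_space_cube)
  interpret pair_sigma_finite unif "cube :: ('i \<Rightarrow> real) measure" ..
  let ?f = "\<lambda>(t, X). X(i := t) :: 'i \<Rightarrow> real"
  have f: "?f \<in> measurable (unif \<Otimes>\<^sub>M cube) cube"
    unfolding split_beta' by (rule measurable_fun_upd[where J=UNIV]) auto
  have "emeasure cube A = emeasure (distr (unif \<Otimes>\<^sub>M cube) cube ?f) A"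
    using distr_pair_PiM_eq_PiM[of UNIV "\<lambda>_::'i. unif" i] prob_space_unif by simp
  also have "\<dots> = emeasure (unif \<Otimes>\<^sub>M cube) (?f -` A \<inter> space (unif \<Otimes>\<^sub>M cube))"
    by (rule emeasure_distr[OF f A])
  also have "\<dots> = (\<integral>\<^sup>+X. emeasure unif ((\<lambda>t. (t, X)) -` (?f -` A \<inter> space (unif \<Otimes>\<^sub>M cube))) \<partial>cube)"
    by (rule emeasure_pair_measure_alt2[OF measurable_sets[OF f A]])
  also have "\<dots> \<le> (\<integral>\<^sup>+X. c \<partial>(cube :: ('i \<Rightarrow> real) measure))"
    using c by (intro nn_integral_mono) (simp add: vimage_def space_pair_measure)
  also have "\<dots> = c" using P.emeasure_space_1 by simp
  finally show ?thesis .
qed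

text \<open>
  On \<open>[-1, 1]\<close> the set is contained in an interval of length \<open>2 * s\<close>, and the density is \<open>1 / 2\<close>.
\<close>

lemma unif_affine_small:
  assumes p: "\<bar>p\<bar> \<ge> p0" "p0 > 0" and s: "s \<ge> 0"
  shows "emeasure unif {t. \<bar>clamp1 t * p + q\<bar> < p0 * s} \<le> ennreal s"
proof -
  let ?A = "{t. \<bar>clamp1 t * p + q\<bar> < p0 * s}"
  have [measurable]: "clamp1 \<in> borel_measurable borel"
    unfolding clamp1_def[abs_def] by measurable
  have sub: "{-1..1} \<inter> ?A \<subseteq> {- q / p - s .. - q / p + s}"
  proof
    fix t assume "t \<in> {-1..1} \<inter> ?A"
    then have "\<bar>t * p + q\<bar> < p0 * s" by (auto simp: clamp1_simps)
    also have "\<dots> \<le> \<bar>p\<bar> * s" using p s by (intro mult_right_mono) auto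
    also have "t * p + q = p * (t + q / p)" using p by (simp add: field_simps)
    finally have "\<bar>p\<bar> * \<bar>t + q / p\<bar> < \<bar>p\<bar> * s" by (simp add: abs_mult)
    then have "\<bar>t + q / p\<bar> < s" by (rule mult_left_less_imp_less) simp
    then show "t \<in> {- q / p - s .. - q / p + s}" by auto
  qed
  have "emeasure unif ?A = emeasure lborel ({-1..1} \<inter> ?A) / emeasure lborel {-1..1::real}"
    by (rule emeasure_uniform_measure) auto
  also have "\<dots> \<le> emeasure lborel {- q / p - s .. - q / p + s} / emeasure lborel {-1..1::real}"
    by (intro divide_right_mono_ennreal emeasure_mono sub) auto
  also have "\<dots> = ennreal (2 * s) / ennreal 2"
    using s by simp
  also have "\<dots> = ennreal s" using s by (subst divide_ennreal) auto
  finally show ?thesis .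
qed

section \<open>Small determinants are unlikely\<close>

text \<open>
  The rows of \<open>A\<close> are put in one at a time, starting from the identity matrix. Let \<open>D I\<close> be the determinant
  when the rows in \<open>I\<close> have been put in. For \<open>l\<close> not in \<open>I\<close>, \<open>D (insert l I)\<close> is affine in the clamped coordinate
  \<open>\<kappa> l\<close> with slope \<open>a * D I\<close>, and \<open>D I\<close> is unaffected by that coordinate. If \<open>D I\<close> is at least
  \<open>(a * s) ^ card I\<close> in absolute value, then \<open>D (insert l I)\<close> is below \<open>(a * s) ^ (card I + 1)\<close>
  in absolute value with conditional probability at most \<open>s\<close>. So each row adds at most \<open>s\<close> to the
  probability of a small determinant.
\<close>

lemma det_anticoncentration:
  fixes A :: "('i::countable \<Rightarrow> real) \<Rightarrow> real ^ 'k ^ 'k" and \<kappa> :: "'k \<Rightarrow> 'i"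
    and a s :: real
  assumes cont: "continuous_on UNIV A"
    and other: "\<And>\<xi> l l' t. l' \<noteq> l \<Longrightarrow> A (\<xi>(\<kappa> l := t)) $ l' = A \<xi> $ l'"
    and diag: "\<And>\<xi> l. \<exists>r. \<forall>t. A (\<xi>(\<kappa> l := t)) $ l = (a * clamp1 t) *\<^sub>R axis l 1 + r"
    and a: "a > 0" and s: "s > 0"
  shows "emeasure cube {\<xi>. \<bar>det (A \<xi>)\<bar> < (a * s) ^ CARD('k)} \<le> ennreal (CARD('k) * s)"
proof -
  define D where "D I \<xi> = det (\<chi> l. if l \<in> I then A \<xi> $ l else axis l 1)" for I \<xi>
  have cA: "continuous_on UNIV (\<lambda>\<xi>. A \<xi> $ i $ j)" for i j
    by (intro continuous_intros cont)
  have contD: "continuous_on UNIV (D I)" for I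
  proof -
    have "continuous_on UNIV (\<lambda>\<xi>. (\<chi> l. if l \<in> I then A \<xi> $ l else axis l 1) $ i $ j)" for i j
      using cA[of i j] by (cases "i \<in> I") auto
    then show ?thesis unfolding D_def[abs_def] det_def
      by (intro continuous_on_sum continuous_on_mult continuous_on_const continuous_on_prod)
  qed
  have meas: "D I \<in> borel_measurable cube" for I
    using borel_measurable_continuous_onI[OF contD] by (simp add: measurable_def sets_cube)
  note [measurable] = meas
  have step: "D (insert l I) (X(\<kappa> l := t)) = clamp1 t * (a * D I X) + q"
    if "l \<notin> I" and r: "\<And>t. A (X(\<kappa> l := t)) $ l = (a * clamp1 t) *\<^sub>R axis l 1 + r"
      and q: "q = det (\<chi> m. if m = l then r else if m \<in> I then A X $ m else axis m 1)" for l I X t r q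
  proof -
    have "D (insert l I) (X(\<kappa> l := t)) =
      det (\<chi> m. if m = l then (a * clamp1 t) *\<^sub>R axis l 1 + r else if m \<in> I then A X $ m else axis m 1)"
      unfolding D_def by (rule arg_cong[where f=det]) (auto simp: vec_eq_iff r other)
    also have "\<dots> = det (\<chi> m. if m = l then (a * clamp1 t) *s axis l 1 else if m \<in> I then A X $ m else axis m 1) + q"
      unfolding q scalar_mult_eq_scaleR by (rule det_row_add)
    also have "det (\<chi> m. if m = l then (a * clamp1 t) *s axis l 1 else if m \<in> I then A X $ m else axis m 1)
       = (a * clamp1 t) * det (\<chi> m. if m = l then axis l 1 else if m \<in> I then A X $ m else axis m 1)"
      by (rule det_row_mul)
    also have "det (\<chi> m. if m = l then axis l 1 else if m \<in> I then A X $ m else axis m 1) = D I X"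
      unfolding D_def using that(1) by (intro arg_cong[where f=det]) (auto simp: vec_eq_iff)
    finally show ?thesis by (simp add: mult_ac fun_upd_def)
  qed
  have inv: "D I (X(\<kappa> l := t)) = D I X" if "l \<notin> I" for l I X t
  proof -
    have "A (X(\<kappa> l := t)) $ m = A X $ m" if "m \<in> I" for m
      by (rule other) (use that \<open>l \<notin> I\<close> in auto)
    then show ?thesis unfolding D_def by (simp cong: if_cong)
  qed
  have "emeasure cube {\<xi>. \<bar>D I \<xi>\<bar> < (a * s) ^ card I} \<le> ennreal (card I * s)" if "finite I" for I
    using that
  proof (induction I)
    case empty
    have "(\<chi> l. axis l 1) = (mat 1 :: real^'k^'k)" by (simp add: vec_eq_iff mat_def axis_def eq_commute)
    then have "D {} \<xi> = 1" for \<xi> by (simp add: D_def)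
    then show ?case by simp
  next
    case (insert l I)
    let ?n = "card I"
    let ?A = "{\<xi>. \<bar>D I \<xi>\<bar> < (a * s) ^ ?n}"
    let ?B = "{\<xi>. (a * s) ^ ?n \<le> \<bar>D I \<xi>\<bar> \<and> \<bar>D (insert l I) \<xi>\<bar> < (a * s) ^ Suc ?n}"
    have "{\<xi> \<in> space cube. \<xi> \<in> ?A} \<in> sets cube" "{\<xi> \<in> space cube. \<xi> \<in> ?B} \<in> sets cube"
      unfolding mem_Collect_eq by measurable
    then have m: "?A \<in> sets cube" "?B \<in> sets cube" by simp_all
    have "emeasure cube ?B \<le> ennreal s"
    proof (rule emeasure_cube_le_slice[OF m(2)])
      fix X
      obtain r where r: "\<And>t. A (X(\<kappa> l := t)) $ l = (a * clamp1 t) *\<^sub>R axis l 1 + r" using diag by blast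
      define q where q: "q = det (\<chi> m. if m = l then r else if m \<in> I then A X $ m else axis m 1)"
      note st = step[OF insert.hyps(2) r q]
      note iv = inv[OF insert.hyps(2)]
      show "emeasure unif {t. X(\<kappa> l := t) \<in> ?B} \<le> ennreal s"
      proof (cases "(a * s) ^ ?n \<le> \<bar>D I X\<bar>")
        case False
        then show ?thesis by (simp add: iv)
      next
        case True
        have "emeasure unif {t. \<bar>clamp1 t * (a * D I X) + q\<bar> < (a * (a * s) ^ ?n) * s} \<le> ennreal s"
          by (rule unif_affine_small) (use a s True in \<open>auto simp: abs_mult\<close>)
        moreover have "(a * s) ^ Suc ?n = (a * (a * s) ^ ?n) * s" by simp
        ultimately show ?thesis using True by (simp only: mem_Collect_eq iv st simp_thms)
      qed
    qed
    then have "emeasure cube ?A + emeasure cube ?B \<le> ennreal (?n * s) + ennreal s"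
      by (rule add_mono[OF insert.IH])
    then have "emeasure cube (?A \<union> ?B) \<le> ennreal (?n * s) + ennreal s"
      by (rule order_trans[OF emeasure_subadditive[OF m]])
    also have "\<dots> = ennreal (card (insert l I) * s)"
      using insert.hyps s by (subst ennreal_plus[symmetric]) (auto simp: algebra_simps)
    finally have "emeasure cube (?A \<union> ?B) \<le> \<dots>" .
    moreover have "{\<xi>. \<bar>D (insert l I) \<xi>\<bar> < (a * s) ^ card (insert l I)} \<subseteq> ?A \<union> ?B"
      using insert.hyps by auto
    ultimately show ?case using m by (meson emeasure_mono order_trans sets.Un)
  qed
  from this[of UNIV] show ?thesis by (simp add: D_def)
qed

section \<open>Random probes supported on a compact set\<close>

text \<open>
  A vector of random series; the row \<open>n\<close> of coefficients serves to make the tuple transversal to the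
  \<open>n\<close>-th subspace.
\<close>

definition probe :: "(nat \<Rightarrow> real) \<Rightarrow> (nat \<Rightarrow> 'k \<Rightarrow> 'a::banach) \<Rightarrow> (nat \<times> 'k \<Rightarrow> real) \<Rightarrow> 'a ^ 'k::finite" where
  "probe w e \<xi> = (\<chi> l. \<Sum>n. (w n * clamp1 (\<xi> (n, l))) *\<^sub>R e n l)"

context
  fixes w :: "nat \<Rightarrow> real" and e :: "nat \<Rightarrow> 'k::finite \<Rightarrow> 'a::banach"
  assumes w: "summable w" "\<And>n. w n > 0" and e: "\<And>n i. norm (e n i) = 1"
begin

lemma probe_term_bound: "norm ((w n * clamp1 t) *\<^sub>R e n l) \<le> w n"
  using w(2)[of n] clamp1_simps(1)[of t] by (simp add: e abs_mult)

lemma probe_summable: "summable (\<lambda>n. (w n * clamp1 (f n)) *\<^sub>R e n l)"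
  by (rule summable_comparison_test'[OF w(1)]) (rule probe_term_bound)

lemma continuous_probe: "continuous_on UNIV (probe w e)"
proof -
  have "continuous_on UNIV (\<lambda>\<xi>. \<Sum>n. (w n * clamp1 (\<xi> (n, l))) *\<^sub>R e n l)" for l
  proof (rule uniform_limit_theorem)
    show "uniform_limit UNIV (\<lambda>N \<xi>. \<Sum>n<N. (w n * clamp1 (\<xi> (n, l))) *\<^sub>R e n l)
        (\<lambda>\<xi>. \<Sum>n. (w n * clamp1 (\<xi> (n, l))) *\<^sub>R e n l) sequentially"
      by (rule Weierstrass_m_test[OF probe_term_bound w(1)])
    show "\<forall>\<^sub>F N in sequentially. continuous_on UNIV (\<lambda>\<xi>. \<Sum>n<N. (w n * clamp1 (\<xi> (n, l))) *\<^sub>R e n l)"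
      by (intro always_eventually allI continuous_intros continuous_clamp1) simp
  qed simp
  then show ?thesis unfolding probe_def[abs_def] by (intro continuous_on_vec_lambda)
qed

text \<open>
  As clamping is idempotent, the range is already the image of the cube, which is compact by
  Tychonoff's theorem.
\<close>

lemma compact_range_probe: "compact (range (probe w e))"
proof -
  let ?K = "PiE (UNIV :: (nat \<times> 'k) set) (\<lambda>_. {-1..1::real})"
  have "compactin (product_topology (\<lambda>_. euclidean) UNIV) ?K"
    by (subst compactin_PiE) auto
  then have "compact ?K" by (simp add: euclidean_product_topology)
  then have "compact (probe w e ` ?K)"
    by (intro compact_continuous_image continuous_on_subset[OF continuous_probe]) auto
  moreover have "probe w e ` ?K = range (probe w e)"
  proof
    show "range (probe w e) \<subseteq> probe w e ` ?K"
    proof clarify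
      fix \<xi> :: "nat \<times> 'k \<Rightarrow> real"
      have "probe w e \<xi> = probe w e (clamp1 \<circ> \<xi>)" by (simp add: probe_def clamp1_simps)
      moreover have "clamp1 \<circ> \<xi> \<in> ?K" by (auto simp: clamp1_def)
      ultimately show "probe w e \<xi> \<in> probe w e ` ?K" by blast
    qed
  qed auto
  ultimately show ?thesis by simp
qed

lemma probe_upd_other: "l' \<noteq> l \<Longrightarrow> probe w e (\<xi>((n, l) := t)) $ l' = probe w e \<xi> $ l'"
  by (simp add: probe_def)

lemma probe_upd: "\<exists>r. \<forall>t. probe w e (\<xi>((n, l) := t)) $ l = (w n * clamp1 t) *\<^sub>R e n l + r"
proof (intro exI allI)
  fix t
  \<comment> \<open>The series without its term of index \<open>n\<close>, which vanishes when the coefficient is set to \<open>0\<close>.\<close>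
  let ?r = "\<lambda>m. (w m * clamp1 ((\<xi>((n, l) := 0)) (m, l))) *\<^sub>R e m l"
  have 0: "clamp1 0 = 0" by (simp add: clamp1_def)
  have "(\<lambda>m. (if m = n then (w n * clamp1 t) *\<^sub>R e n l else 0) + ?r m) sums ((w n * clamp1 t) *\<^sub>R e n l + suminf ?r)"
    by (intro sums_add sums_single summable_sums probe_summable)
  also have "(\<lambda>m. (if m = n then (w n * clamp1 t) *\<^sub>R e n l else 0) + ?r m)
      = (\<lambda>m. (w m * clamp1 ((\<xi>((n, l) := t)) (m, l))) *\<^sub>R e m l)"
    by (auto simp: 0)
  finally show "probe w e (\<xi>((n, l) := t)) $ l = (w n * clamp1 t) *\<^sub>R e n l + suminf ?r"
    by (simp add: probe_def sums_iff)
qed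

end

text \<open>
  Changing the coefficient \<open>(n, l)\<close> moves component \<open>l\<close> of the probe along \<open>e n l\<close>, which by orthonormality
  affects only the diagonal entry of the row \<open>l\<close>.
\<close>

lemma det_gram_probe_small:
  fixes e :: "nat \<Rightarrow> 'k::finite \<Rightarrow> 'a::{real_inner, banach}" and s :: real
  assumes orth: "\<And>n i j. inner (e n i) (e n j) = (if i = j then 1 else 0)"
    and w: "summable w" "\<And>n. w n > 0" and s: "s > 0"
  shows "emeasure cube {\<xi>. \<bar>det (gram (e n) (probe w e \<xi> - y))\<bar> < (w n * s) ^ CARD('k)}
    \<le> ennreal (CARD('k) * s)"
proof (rule det_anticoncentration[where \<kappa> = "\<lambda>l. (n, l)" and a = "w n"])
  have e1: "norm (e n i) = 1" for n i using orth[of n i i] by (simp add: norm_eq_1)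
  note pr = w e1
  show "continuous_on UNIV (\<lambda>\<xi>. gram (e n) (probe w e \<xi> - y))"
    by (intro continuous_gram continuous_intros continuous_probe[of w e, OF pr])
  show "gram (e n) (probe w e (\<xi>((n, l) := t)) - y) $ l' = gram (e n) (probe w e \<xi> - y) $ l'"
    if "l' \<noteq> l" for \<xi> l l' t
    by (simp add: gram_def probe_upd_other[of w e, OF pr that])
  fix \<xi> l
  obtain r where r: "\<And>t. probe w e (\<xi>((n, l) := t)) $ l = (w n * clamp1 t) *\<^sub>R e n l + r"
    using probe_upd[of w e, OF pr] by blast
  show "\<exists>r. \<forall>t. gram (e n) (probe w e (\<xi>((n, l) := t)) - y) $ l = (w n * clamp1 t) *\<^sub>R axis l 1 + r"
    by (rule exI[of _ "\<chi> i. inner (e n i) (r - y $ l)"])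
      (auto simp: gram_def vec_eq_iff r orth axis_def inner_add_right inner_diff_right)
qed (use w s in auto)

section \<open>Prevalence\<close>

theorem theorem3p14:
  fixes V :: "nat \<Rightarrow> 'a::{real_inner, banach} set"
  assumes "\<And>j. j \<ge> 1 \<Longrightarrow> V j \<in> closed_subspaces_of_codim CARD('k::finite)"
  shows "prevalent {x :: 'a ^ 'k.
           well_separating_complement CARD('k) V (span (range (\<lambda>i. x $ i)))}"
proof -
  let ?k = "CARD('k)"
  have "\<forall>n. \<exists>e :: 'k \<Rightarrow> 'a. (\<forall>i j. inner (e i) (e j) = (if i = j then 1 else 0))
           \<and> V (Suc n) = {x. \<forall>i. inner (e i) x = 0}"
    by (intro allI orthonormal_normal_vectors assms) simp
  from choice[OF this] obtain e :: "nat \<Rightarrow> 'k \<Rightarrow> 'a" where *: "\<forall>n. (\<forall>i j. inner (e n i) (e n j) = (if i = j then 1 else 0))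
           \<and> V (Suc n) = {x. \<forall>i. inner (e n i) x = 0}" ..
  then have orth: "\<And>n i j. inner (e n i) (e n j) = (if i = j then 1 else 0)"
      and V: "\<And>n. V (Suc n) = {x. \<forall>i. inner (e n i) x = 0}"
    by simp_all
  have e1: "norm (e n i) = 1" for n i using orth[of n i i] by (simp add: norm_eq_1)
  define w where "w n = 1 / real (Suc n) ^ 2" for n
  have w0: "w n > 0" for n by (simp add: w_def)
  have w: "summable w"
    using summable_Suc_iff[of "\<lambda>n. inverse (real n ^ 2)"] inverse_power_summable[of 2, where 'a=real]
    by (simp add: w_def[abs_def] inverse_eq_divide)
  note pr = w w0 e1
  define G where "G n x = det (gram (e n) x)" for n and x :: "'a ^ 'k"
  \<comment> \<open>The quantifier over \<open>\<epsilon>\<close> is restricted to the values \<open>1 / (m + 1)\<close>, which makes \<open>E\<close> a countable union of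
    closed sets.\<close>
  define E where "E = (\<Union>m. \<Inter>n. {x. (w n * (inverse (real (Suc m)) * w n)) ^ ?k \<le> \<bar>G n x\<bar>})"
  have contG: "continuous_on UNIV (G n)" for n
    unfolding G_def[abs_def] by (intro continuous_det continuous_gram continuous_intros)
  have E_borel: "E \<in> sets borel"
    unfolding E_def
    by (intro sets.countable_UN sets.countable_INT subsetI)
      (auto intro!: borel_closed closed_Collect_le continuous_intros contG)
  have E_sub: "E \<subseteq> {x. well_separating_complement ?k V (span (range (\<lambda>i. x $ i)))}"
  proof
    fix x assume "x \<in> E"
    then obtain m where "\<And>n. (w n * (inverse (real (Suc m)) * w n)) ^ ?k \<le> \<bar>G n x\<bar>"
      by (auto simp: E_def)
    then have "well_separating_complement ?k V (span (range (\<lambda>i. x $ i)))"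
      by (intro well_separating_if_det_bound[where e = e and V = V and \<epsilon> = "inverse (real (Suc m))", OF orth V])
        (auto simp: G_def w_def)
    then show "x \<in> {x. well_separating_complement ?k V (span (range (\<lambda>i. x $ i)))}" by simp
  qed
  define \<mu> where "\<mu> = distr cube borel (probe w e)"
  have probe_meas: "probe w e \<in> measurable cube borel"
    using borel_measurable_continuous_onI[OF continuous_probe[of w e, OF pr]]
    by (simp add: measurable_def sets_cube)
  interpret P: prob_space "cube :: (nat \<times> 'k \<Rightarrow> real) measure" by (rule prob_space_cube)
  have "probe w e -` range (probe w e) = UNIV" by auto
  then have "emeasure \<mu> (range (probe w e)) = 1"
    unfolding \<mu>_def
    using compact_range_probe[of w e, OF pr] probe_meas P.emeasure_space_1
    by (subst emeasure_distr) (auto simp: borel_compact)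
  then have compact: "\<exists>K. compact K \<and> 0 < emeasure \<mu> K \<and> emeasure \<mu> K < \<infinity>"
    using compact_range_probe[of w e, OF pr] by (intro exI[of _ "range (probe w e)"]) simp
  have null: "UNIV - (\<lambda>x. x + y) ` E \<in> null_sets \<mu>" for y
  proof -
    let ?N = "UNIV - (\<lambda>x. x + y) ` E"
    have N: "?N = (\<lambda>x. x - y) -` (- E)"
      by (auto simp: image_iff) (metis diff_add_cancel)
    have meas_shift: "(\<lambda>x. x - y) \<in> measurable borel borel"
      by (intro borel_measurable_continuous_onI continuous_intros)
    have N_borel: "?N \<in> sets borel"
      unfolding N using measurable_sets[OF meas_shift, of "- E"] E_borel by auto
    define B where "B m n = {\<xi>. \<bar>G n (probe w e \<xi> - y)\<bar> < (w n * (inverse (real (Suc m)) * w n)) ^ ?k}" for m n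
    have contB: "continuous_on UNIV (\<lambda>\<xi>. G n (probe w e \<xi> - y))" for n
      unfolding G_def by (intro continuous_det continuous_gram continuous_intros continuous_probe[of w e, OF pr])
    have B_sets: "B m n \<in> sets cube" for m n
      unfolding sets_cube B_def
      by (intro borel_open open_Collect_less continuous_intros contB)
    have "emeasure \<mu> ?N \<le> ennreal (?k * suminf w * inverse (real (Suc m)))" for m
    proof -
      have "emeasure \<mu> ?N = emeasure cube (probe w e -` ?N)"
        unfolding \<mu>_def using emeasure_distr[OF probe_meas N_borel] by simp
      also have "\<dots> \<le> emeasure cube (\<Union>n. B m n)"
        unfolding N by (rule emeasure_mono) (use B_sets in \<open>auto simp: E_def B_def not_le simp del: of_nat_Suc\<close>)
      also have "\<dots> \<le> (\<Sum>n. emeasure cube (B m n))"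
        by (rule emeasure_subadditive_countably) (use B_sets in auto)
      also have "\<dots> \<le> (\<Sum>n. ennreal (?k * (inverse (real (Suc m)) * w n)))"
        unfolding B_def G_def
        by (intro suminf_le summableI det_gram_probe_small[where e = e and w = w, OF orth w w0]) (simp add: w0)
      also have "\<dots> = ennreal (\<Sum>n. ?k * (inverse (real (Suc m)) * w n))"
        by (rule suminf_ennreal2) (use w w0 in \<open>auto intro!: summable_mult mult_nonneg_nonneg less_imp_le\<close>)
      also have "(\<Sum>n. ?k * (inverse (real (Suc m)) * w n)) = ?k * suminf w * inverse (real (Suc m))"
        using w by (simp add: suminf_mult summable_mult)
      finally show ?thesis .
    qed
    moreover have "(\<lambda>m. ennreal (?k * suminf w * inverse (real (Suc m)))) \<longlonglongrightarrow> ennreal (?k * suminf w * 0)"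
      by (intro tendsto_ennrealI tendsto_mult tendsto_const LIMSEQ_inverse_real_of_nat)
    ultimately have "emeasure \<mu> ?N \<le> ennreal (?k * suminf w * 0)"
      by (intro LIMSEQ_le_const) auto
    then show ?thesis using N_borel by (simp add: null_sets_def \<mu>_def)
  qed
  have "prevalent_borel E"
    unfolding prevalent_borel_def
    by (intro conjI E_borel exI[of _ \<mu>] compact allI null) (simp add: \<mu>_def)
  then show ?thesis using E_sub unfolding prevalent_def by blast
qed

end
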